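(* Let $r\ge2$ and consider the DeGroot model on $(\langle r\rangle,p_0,(P_n)_{n\ge1})$. Suppose that for some $t\ge1$ there are partitions $\Delta_1,\dots,\Delta_{t+1}$ of $\langle r\rangle$ such that $P_1\in G_{\Delta_2,\Delta_1}\subseteq S_r$, $P_2\in G_{\Delta_3,\Delta_2}\subseteq S_r$, $\dots$, $P_t\in G_{\Delta_{t+1},\Delta_t}\subseteq S_r$, with $\Delta_{t+1}=(\langle r\rangle)$ and $$\Delta_1=(\{j\},K^c)_{j\in K}\quad(\emptyset\ne K\subseteq\langle r\rangle,\ K^c=\langle r\rangle\setminus K).$$ Then: (a) $(P_tP_{t-1}\cdots P_1)^K$ (equivalently, $P_tP_{t-1}\cdots P_2P_1^K$) is a stable matrix (a matrix with identical rows). (b) For all $i\in\langle r\rangle$, $$(P_tP_{t-1}\cdots P_1)^K_{\{i\}}=\left(P_t^{-+}P_{t-1}^{-+}\cdots P_1^{-+}\right)^{\bigcup_{j\in K}\{\{j\}\}}=P_t^{-+}P_{t-1}^{-+}\cdots P_2^{-+}\left(P_1^K\right)^{-+},$$ where $P_b^{-+}=P_b^{-+(\Delta_{b+1},\Delta_b)}$ for $b\in\langle t\rangle$ and $(P_1^K)^{-+}=(P_1^K)^{-+(\Delta_2,(\{j\})_{j\in K})}$; and, with $e=e(r)=(1,\dots,1)\in\mathbb{R}^r$, $$(P_tP_{t-1}\cdots P_1)^K=e'\left(P_t^{-+}P_{t-1}^{-+}\cdots P_1^{-+}\right)^{\bigcup_{j\in K}\{\{j\}\}}=e'P_t^{-+}P_{t-1}^{-+}\cdots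 P_2^{-+}\left(P_1^K\right)^{-+}.$$ (c) For all $n\ge t$ and all $l\in\langle r\rangle$, $$p_{nl}=\begin{cases}\displaystyle\sum_{j\in\langle r\rangle}\left(P_t^{-+}P_{t-1}^{-+}\cdots P_1^{-+}\right)_{\langle r\rangle\{j\}}p_{0j}&\text{if }|K^c|\le1,\\[2ex]\displaystyle\sum_{j\in K}\left(P_t^{-+}P_{t-1}^{-+}\cdots P_1^{-+}\right)_{\langle r\rangle\{j\}}p_{0j}+\sum_{u\in K^c}(P_nP_{n-1}\cdots P_1)_{lu}\,p_{0u}&\text{if }|K^c|>1.\end{cases}$$ Thus, for $n\ge t$, the linear combination $\sum_{j\in K}(P_t^{-+}\cdots P_1^{-+})_{\langle r\rangle\{j\}}p_{0j}$ of the $p_{0j}$, $j\in K$, does not depend on $n$ and $l$: when $|K^c|\le1$, a (total) consensus is reached at time $t$, and it is $\sum_{j\in\langle r\rangle}(P_t^{-+}\cdots P_1^{-+})_{\langle r\rangle\{j\}}p_{0j}$; when $|K^c|>1$, $\sum_{j\in K}(P_t^{-+}\cdots P_1^{-+})_{\langle r\rangle\{j\}}p_{0j}$ is a partial consensus reached at time $t$ for the initial opinions $p_{0j}$, $j\in K$.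
   Context: For $m\ge1$, $\langle m\rangle=\{1,2,\dots,m\}$. Vectors are row vectors and $'$ denotes transpose. $S_r$ is the set of (row) stochastic $r\times r$ matrices. *DeGroot model on* $(\langle r\rangle,p_0,(P_n)_{n\ge1})$: $p_0=(p_{01},\dots,p_{0r})$ is a vector (real or complex) of initial opinions, $(P_n)_{n\ge1}$ is a sequence of matrices in $S_r$, and the opinion vectors $p_n=(p_{n1},\dots,p_{nr})$ are defined by $p_n'=P_np_{n-1}'$, $n\ge1$, so $p_n'=P_nP_{n-1}\cdots P_1p_0'$. A *consensus* is reached if all components of $p_n$ converge to the same limit as $n\to\infty$; that limit is the consensus. It is reached at time $t$ when $p_{nl}$ equals that value for all $n\ge t$ and all $l$. A *partial consensus* for the $p_{0j}$, $j\in K$, reached at time $t$ means that for all $n\ge t$ and all $l$ the contribution of the $p_{0j}$, $j\in K$, to $p_{nl}$, namely $\sum_{j\in K}(P_n\cdots P_1)_{lj}p_{0j}$, is the stated value, independent of $n$ and $l$. Partitions do not contain the empty set; $(\langle r\rangle)$ is the one-block partition, and $(\{j\},K^c)_{j\in K}$ is the partition consisting of the singletons $\{j\}$, $j\in K$, together with the block $K^c$ if $K^c\neq\emptyset$ (so it is the partition into singletons if $|K^c|\le1$). For a matrix $P$ and nonempty sets $U$ of row indices and $V$ of column indices: $P_U$, $P^V$, $P_U^V$ are the submatrices with rows in $U$, with columns in $V$, and with rows in $U$ and columns in $V$, respectively. For a matrix $Q$ whose columns are labelled by sets, $Q^{\bigcup_{j\in K}\{\{j\}\}}$ is the submatrix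 formed by the columns labelled $\{j\}$, $j\in K$. A matrix is *generalized stochastic* if all its row sums equal one and the same number. For partitions $\Delta,\Sigma$ of $\langle r\rangle$, $G_{\Delta,\Sigma}$ is the set of $P\in S_r$ such that $P_U^V$ is generalized stochastic for all $U\in\Delta$, $V\in\Sigma$. For such $P$, the *grouped matrix* $P^{-+}=P^{-+(\Delta,\Sigma)}$ has rows indexed by $U\in\Delta$, columns indexed by $V\in\Sigma$, and entry $(U,V)$ equal to the common value $\sum_{j\in V}P_{ij}$, $i\in U$; the same definition is applied to $P_1^K$ with column partition $(\{j\})_{j\in K}$ of $K$. The matrix $P_t^{-+}\cdots P_1^{-+}$ has a single row, labelled $\langle r\rangle$. For $t=1$ the product $P_t^{-+}\cdots P_2^{-+}(P_1^K)^{-+}$ means $(P_1^K)^{-+}$ and $P_t\cdots P_2P_1^K$ means $P_1^K$. Equalities between matrices with columns labelled $j\in K$ and matrices with columns labelled $\{j\}$, $j\in K$, are understood by identifying column $j$ with column $\{j\}$ (and, for one-row matrices, identifying the row labels). *)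

theory Defs
  imports Complex_Main "HOL-Library.Disjoint_Sets"
begin

text \<open>
  Real matrices whose rows and columns are labelled by the elements of arbitrary sets: the
  grouped matrices below have blocks of partitions as labels, and submatrices keep their labels.
  Entries outside the label sets are normalised to 0, so HOL equality is equality of labelled
  matrices: same row labels, same column labels, same entries.
\<close>

typedef ('i, 'j) lmat =
  "{(I :: 'i set, J :: 'j set, f :: 'i \<Rightarrow> 'j \<Rightarrow> real). \<forall>i j. i \<notin> I \<or> j \<notin> J \<longrightarrow> f i j = 0}"
  by (rule exI[of _ "({}, {}, \<lambda>_ _. 0)"]) simp

setup_lifting type_definition_lmat

lift_definition row_labels :: "('i, 'j) lmat \<Rightarrow> 'i set" is "\<lambda>(I, J, f). I" .

lift_definition col_labels :: "('i, 'j) lmat \<Rightarrow> 'j set" is "\<lambda>(I, J, f). J" .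

lift_definition entry :: "('i, 'j) lmat \<Rightarrow> 'i \<Rightarrow> 'j \<Rightarrow> real" is "\<lambda>(I, J, f). f" .

lift_definition lmat :: "'i set \<Rightarrow> 'j set \<Rightarrow> ('i \<Rightarrow> 'j \<Rightarrow> real) \<Rightarrow> ('i, 'j) lmat"
  is "\<lambda>I J f. (I, J, \<lambda>i j. if i \<in> I \<and> j \<in> J then f i j else 0)" by auto

lemma row_labels_lmat [simp]: "row_labels (lmat I J f) = I"
  by transfer simp

lemma col_labels_lmat [simp]: "col_labels (lmat I J f) = J"
  by transfer simp

lemma entry_lmat [simp]: "entry (lmat I J f) i j = (if i \<in> I \<and> j \<in> J then f i j else 0)"
  by transfer simp

lemma entry_outside: "i \<notin> row_labels A \<or> j \<notin> col_labels A \<Longrightarrow> entry A i j = 0"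
  by transfer auto

lemma lmat_eqI:
  assumes "row_labels A = row_labels B" "col_labels A = col_labels B"
    and "\<And>i j. i \<in> row_labels A \<Longrightarrow> j \<in> col_labels A \<Longrightarrow> entry A i j = entry B i j"
  shows "A = B"
  using assms by transfer (force simp: fun_eq_iff)

text \<open>Meant for factors with \<open>col_labels A = row_labels B\<close>.\<close>

definition lmult :: "('i, 'j) lmat \<Rightarrow> ('j, 'k) lmat \<Rightarrow> ('i, 'k) lmat"  (infixl "\<cdot>" 70) where
  "A \<cdot> B = lmat (row_labels A) (col_labels B) (\<lambda>i k. \<Sum>j\<in>col_labels A. entry A i j * entry B j k)"

text \<open>\<open>submat A U V\<close> is $A_U^V$, \<open>sub_rows A U\<close> is $A_U$ and \<open>sub_cols A V\<close> is $A^V$.\<close>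

definition submat :: "('i, 'j) lmat \<Rightarrow> 'i set \<Rightarrow> 'j set \<Rightarrow> ('i, 'j) lmat" where
  "submat A U V = lmat (row_labels A \<inter> U) (col_labels A \<inter> V) (entry A)"

definition sub_rows :: "('i, 'j) lmat \<Rightarrow> 'i set \<Rightarrow> ('i, 'j) lmat" where
  "sub_rows A U = submat A U (col_labels A)"

definition sub_cols :: "('i, 'j) lmat \<Rightarrow> 'j set \<Rightarrow> ('i, 'j) lmat" where
  "sub_cols A V = submat A (row_labels A) V"

text \<open>
  \<open>eq_relabel f g A B\<close>: the matrices \<open>A\<close> and \<open>B\<close> are equal when row \<open>i\<close> of \<open>A\<close> is identified with
  row \<open>f i\<close> of \<open>B\<close> and column \<open>j\<close> of \<open>A\<close> with column \<open>g j\<close> of \<open>B\<close>.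
\<close>

definition eq_relabel ::
  "('i \<Rightarrow> 'k) \<Rightarrow> ('j \<Rightarrow> 'l) \<Rightarrow> ('i, 'j) lmat \<Rightarrow> ('k, 'l) lmat \<Rightarrow> bool" where
  "eq_relabel f g A B \<longleftrightarrow>
     bij_betw f (row_labels A) (row_labels B) \<and>
     bij_betw g (col_labels A) (col_labels B) \<and>
     (\<forall>i\<in>row_labels A. \<forall>j\<in>col_labels A. entry A i j = entry B (f i) (g j))"

text \<open>
  \<open>back_prod M n X\<close> is $M_n M_{n-1} \cdots M_2 X$, and \<open>X\<close> if \<open>n = 1\<close>; thus
  \<open>back_prod M n (M 1)\<close> is $M_n \cdots M_1$ for \<open>n \<ge> 1\<close>.  The value at \<open>n = 0\<close> is irrelevant.
\<close>

definition back_prod :: "(nat \<Rightarrow> ('i, 'i) lmat) \<Rightarrow> nat \<Rightarrow> ('i, 'j) lmat \<Rightarrow> ('i, 'j) lmat" where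
  "back_prod M n X = fold (\<lambda>k Y. M k \<cdot> Y) [2..<Suc n] X"

abbreviation full_prod :: "(nat \<Rightarrow> ('i, 'i) lmat) \<Rightarrow> nat \<Rightarrow> ('i, 'i) lmat" where
  "full_prod M n \<equiv> back_prod M n (M 1)"

definition stochastic_matrices :: "nat \<Rightarrow> (nat, nat) lmat set" where
  "stochastic_matrices r =
     {A. row_labels A = {1..r} \<and> col_labels A = {1..r} \<and>
         (\<forall>i\<in>{1..r}. \<forall>j\<in>{1..r}. 0 \<le> entry A i j) \<and>
         (\<forall>i\<in>{1..r}. (\<Sum>j\<in>{1..r}. entry A i j) = 1)}"

definition generalized_stochastic :: "('i, 'j) lmat \<Rightarrow> bool" where
  "generalized_stochastic A \<longleftrightarrow>
     (\<exists>c. \<forall>i\<in>row_labels A. (\<Sum>j\<in>col_labels A. entry A i j) = c)"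

definition stable_matrix :: "('i, 'j) lmat \<Rightarrow> bool" where
  "stable_matrix A \<longleftrightarrow>
     (\<forall>i\<in>row_labels A. \<forall>k\<in>row_labels A. \<forall>j\<in>col_labels A. entry A i j = entry A k j)"

text \<open>\<open>G_set r D S\<close> is $G_{D,S}$ for partitions \<open>D\<close> and \<open>S\<close> of $\langle r\rangle$.\<close>

definition G_set :: "nat \<Rightarrow> nat set set \<Rightarrow> nat set set \<Rightarrow> (nat, nat) lmat set" where
  "G_set r D S =
     {A \<in> stochastic_matrices r. \<forall>U\<in>D. \<forall>V\<in>S. generalized_stochastic (submat A U V)}"

text \<open>
  The grouped matrix $A^{-+(D,S)}$.  The common value is unique because blocks are nonempty, and
  it exists when all \<open>submat A U V\<close> are generalized stochastic.
\<close>

definition grouped :: "('i, 'j) lmat \<Rightarrow> 'i set set \<Rightarrow> 'j set set \<Rightarrow> ('i set, 'j set) lmat" where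
  "grouped A D S = lmat D S (\<lambda>U V. THE c. \<forall>i\<in>U. (\<Sum>j\<in>V. entry A i j) = c)"

text \<open>\<open>grouped_seq P \<Delta> b\<close> is $P_b^{-+} = P_b^{-+(\Delta_{b+1},\Delta_b)}$.\<close>

definition grouped_seq ::
  "(nat \<Rightarrow> ('i, 'i) lmat) \<Rightarrow> (nat \<Rightarrow> 'i set set) \<Rightarrow> nat \<Rightarrow> ('i set, 'i set) lmat" where
  "grouped_seq P \<Delta> b = grouped (P b) (\<Delta> (b + 1)) (\<Delta> b)"

definition singletons :: "'i set \<Rightarrow> 'i set set" where
  "singletons K = (\<lambda>j. {j}) ` K"

text \<open>The partition $(\{j\},K^c)_{j\in K}$ of $\langle r\rangle$.\<close>

definition singletons_and_rest :: "nat \<Rightarrow> nat set \<Rightarrow> nat set set" where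
  "singletons_and_rest r K =
     singletons K \<union> (if {1..r} - K = {} then {} else {{1..r} - K})"

text \<open>
  The column $e'$.  Its only column is labelled by the block $\langle r\rangle$, the label of the
  single row of the matrices it is multiplied by.
\<close>

definition ones_column :: "nat \<Rightarrow> (nat, nat set) lmat" where
  "ones_column r = lmat {1..r} {{1..r}} (\<lambda>_ _. 1)"

text \<open>
  Opinions lie in a real normed field, i.e. they are real or complex numbers.  \<open>P 0\<close> is never used.
\<close>

primrec opinion ::
  "nat \<Rightarrow> (nat \<Rightarrow> (nat, nat) lmat) \<Rightarrow> (nat \<Rightarrow> 'a::real_normed_field) \<Rightarrow> nat \<Rightarrow> nat \<Rightarrow> 'a" where
  "opinion r P p0 0 = p0"
| "opinion r P p0 (Suc n) = (\<lambda>i. \<Sum>j\<in>{1..r}. entry (P (Suc n)) i j *\<^sub>R opinion r P p0 n j)"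

definition consensus ::
  "nat \<Rightarrow> (nat \<Rightarrow> (nat, nat) lmat) \<Rightarrow> (nat \<Rightarrow> 'a::real_normed_field) \<Rightarrow> 'a \<Rightarrow> bool" where
  "consensus r P p0 c \<longleftrightarrow> (\<forall>l\<in>{1..r}. (\<lambda>n. opinion r P p0 n l) \<longlonglongrightarrow> c)"

definition consensus_at ::
  "nat \<Rightarrow> (nat \<Rightarrow> (nat, nat) lmat) \<Rightarrow> (nat \<Rightarrow> 'a::real_normed_field) \<Rightarrow> nat \<Rightarrow> 'a \<Rightarrow> bool" where
  "consensus_at r P p0 t c \<longleftrightarrow>
     consensus r P p0 c \<and> (\<forall>n\<ge>t. \<forall>l\<in>{1..r}. opinion r P p0 n l = c)"

text \<open>
  \<open>contribution P p0 K n l\<close> is the contribution of the initial opinions $p_{0j}$, $j\in K$, to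
  $p_{nl}$, for \<open>n \<ge> 1\<close>.
\<close>

definition contribution ::
  "(nat \<Rightarrow> (nat, nat) lmat) \<Rightarrow> (nat \<Rightarrow> 'a::real_normed_field) \<Rightarrow> nat set \<Rightarrow> nat \<Rightarrow> nat \<Rightarrow> 'a" where
  "contribution P p0 K n l = (\<Sum>j\<in>K. entry (full_prod P n) l j *\<^sub>R p0 j)"

definition partial_consensus_at ::
  "nat \<Rightarrow> (nat \<Rightarrow> (nat, nat) lmat) \<Rightarrow> (nat \<Rightarrow> 'a::real_normed_field) \<Rightarrow> nat set \<Rightarrow> nat \<Rightarrow> 'a \<Rightarrow> bool"
  where
  "partial_consensus_at r P p0 K t c \<longleftrightarrow> (\<forall>n\<ge>t. \<forall>l\<in>{1..r}. contribution P p0 K n l = c)"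

end

theory Submission imports Defs begin

text \<open>
  The whole argument rests on one fact: grouping is multiplicative.  Let \<open>A\<close> have constant block
  row sums with respect to row partition \<open>D\<close> and column partition \<open>E\<close>, and \<open>B\<close> with respect to
  \<open>E\<close> and \<open>F\<close>.  For a row \<open>i\<close> in a block \<open>U\<close> of \<open>D\<close> and a block \<open>V\<close> of \<open>F\<close>,
  \[ \sum_{j\in V}(AB)_{ij} = \sum_k A_{ik}\sum_{j\in V}B_{kj}
       = \sum_{W\in E}\Bigl(\sum_{k\in W}A_{ik}\Bigr)(B^{-+})_{WV}
       = \sum_{W\in E}(A^{-+})_{UW}(B^{-+})_{WV}, \]
  because the inner sum depends on \<open>k\<close> only through its block \<open>W\<close>.  The right-hand side no longer
  mentions \<open>i\<close>, so \<open>AB\<close> again has constant block row sums and $(AB)^{-+}=A^{-+}B^{-+}$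
  (\<open>block_generalized_stochastic_lmult\<close>, \<open>grouped_lmult\<close>).

  By induction (\<open>full_prod_grouped\<close>), the product $P_t\cdots P_1$ has constant block row sums for
  $\Delta_{t+1}$ and $\Delta_1$.  Since $\Delta_{t+1}$ has the single block $\langle r\rangle$ and
  $\Delta_1$ contains $\{j\}$ for every $j\in K$, a block row sum here is a single entry, and
  column \<open>j\<close> of the product is constant, with the value at \<open>{j}\<close> of the one-row matrix
  $P_t^{-+}\cdots P_1^{-+}$.  This gives the stability of the columns in \<open>K\<close> and their
  values; the variants with $P_1^K$ follow because selecting columns commutes with
  multiplication from the left.  Multiplying further from the left by stochastic
  matrices leaves a constant column unchanged, so the same entries persist for all $n\ge t$
  (\<open>constant_column_persists\<close>), and the opinions follow by expanding $p_n'=P_n\cdots P_1p_0'$.  If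
  $|K^c|\le1$, then $K^c$ is itself empty or a singleton block, and every column is constant.
\<close>

section \<open>Products of labelled matrices\<close>

lemma row_labels_lmult [simp]: "row_labels (A \<cdot> B) = row_labels A"
  by (simp add: lmult_def)

lemma col_labels_lmult [simp]: "col_labels (A \<cdot> B) = col_labels B"
  by (simp add: lmult_def)

lemma entry_lmult:
  "i \<in> row_labels A \<Longrightarrow> k \<in> col_labels B \<Longrightarrow>
    entry (A \<cdot> B) i k = (\<Sum>j\<in>col_labels A. entry A i j * entry B j k)"
  by (simp add: lmult_def)

lemma row_labels_sub_cols [simp]: "row_labels (sub_cols A V) = row_labels A"
  by (simp add: sub_cols_def submat_def)

lemma col_labels_sub_cols [simp]: "col_labels (sub_cols A V) = col_labels A \<inter> V"
  by (simp add: sub_cols_def submat_def)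

lemma entry_sub_cols: "j \<in> V \<Longrightarrow> entry (sub_cols A V) i j = entry A i j"
  using entry_outside[of i A j] by (auto simp: sub_cols_def submat_def)

lemma sub_cols_lmult: "sub_cols (A \<cdot> B) V = A \<cdot> sub_cols B V"
  by (rule lmat_eqI) (simp_all add: entry_lmult entry_sub_cols)

lemma back_prod_1 [simp]: "back_prod M (Suc 0) X = X"
  by (simp add: back_prod_def)

lemma back_prod_Suc: "n \<ge> 1 \<Longrightarrow> back_prod M (Suc n) X = M (Suc n) \<cdot> back_prod M n X"
  by (simp add: back_prod_def)

lemma sub_cols_back_prod:
  assumes "n \<ge> 1"
  shows "sub_cols (back_prod M n X) V = back_prod M n (sub_cols X V)"
  using assms by (induction n rule: dec_induct) (simp_all add: back_prod_Suc sub_cols_lmult)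

lemma col_labels_back_prod [simp]:
  assumes "n \<ge> 1"
  shows "col_labels (back_prod M n X) = col_labels X"
  using assms by (induction n rule: dec_induct) (simp_all add: back_prod_Suc)

lemma row_labels_full_prod:
  assumes "n \<ge> 1"
  shows "row_labels (full_prod M n) = row_labels (M n)"
  using assms by (induction n rule: dec_induct) (simp_all add: back_prod_Suc)

section \<open>Multiplicativity of grouping\<close>

definition block_generalized_stochastic ::
  "('i, 'j) lmat \<Rightarrow> 'i set set \<Rightarrow> 'j set set \<Rightarrow> bool" where
  "block_generalized_stochastic A D S \<longleftrightarrow>
     (\<forall>U\<in>D. \<forall>V\<in>S. generalized_stochastic (submat A U V))"

lemma block_generalized_stochasticI:
  assumes "partition_on (row_labels A) D" and "partition_on (col_labels A) S"
    and "\<And>U V i. U \<in> D \<Longrightarrow> V \<in> S \<Longrightarrow> i \<in> U \<Longrightarrow> (\<Sum>j\<in>V. entry A i j) = c U V"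
  shows "block_generalized_stochastic A D S"
  unfolding block_generalized_stochastic_def generalized_stochastic_def
proof (intro ballI exI)
  fix U V i
  assume U: "U \<in> D" and V: "V \<in> S" and i: "i \<in> row_labels (submat A U V)"
  have "V \<subseteq> col_labels A"
    using V partition_onD1[OF assms(2)] by blast
  then have "(\<Sum>j\<in>col_labels (submat A U V). entry (submat A U V) i j) = (\<Sum>j\<in>V. entry A i j)"
    using i by (intro sum.cong) (auto simp: submat_def)
  also have "\<dots> = c U V"
    using assms(3) U V i by (auto simp: submat_def)
  finally show "(\<Sum>j\<in>col_labels (submat A U V). entry (submat A U V) i j) = c U V" .
qed

lemma row_labels_grouped [simp]: "row_labels (grouped A D S) = D"
  and col_labels_grouped [simp]: "col_labels (grouped A D S) = S"
  by (simp_all add: grouped_def)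

text \<open>
  An empty block \<open>U\<close> has to be excluded: every number is a common value of its empty set of row
  sums, so the description defining the entry would not single out \<open>c\<close>.
\<close>

lemma entry_groupedI:
  assumes "U \<in> D" and "V \<in> S" and "U \<noteq> {}"
    and "\<And>i. i \<in> U \<Longrightarrow> (\<Sum>j\<in>V. entry A i j) = c"
  shows "entry (grouped A D S) U V = c"
proof -
  have "(THE c. \<forall>i\<in>U. (\<Sum>j\<in>V. entry A i j) = c) = c"
    using assms(3,4) by (intro the_equality) auto
  then show ?thesis
    using assms(1,2) by (simp add: grouped_def)
qed

lemma block_sum_eq_entry_grouped:
  assumes D: "partition_on (row_labels A) D" and S: "partition_on (col_labels A) S"
    and A: "block_generalized_stochastic A D S"
    and U: "U \<in> D" and V: "V \<in> S" and i: "i \<in> U"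
  shows "(\<Sum>j\<in>V. entry A i j) = entry (grouped A D S) U V"
proof -
  have sub: "U \<subseteq> row_labels A" "V \<subseteq> col_labels A"
    using U V partition_onD1[OF D] partition_onD1[OF S] by blast+
  then have lab: "row_labels (submat A U V) = U" "col_labels (submat A U V) = V"
    by (auto simp: submat_def)
  obtain c where "\<forall>k\<in>U. (\<Sum>j\<in>V. entry (submat A U V) k j) = c"
    using A U V lab unfolding block_generalized_stochastic_def generalized_stochastic_def by metis
  moreover have "(\<Sum>j\<in>V. entry (submat A U V) k j) = (\<Sum>j\<in>V. entry A k j)" if "k \<in> U" for k
    using that sub by (intro sum.cong) (auto simp: submat_def)
  ultimately have c: "(\<Sum>j\<in>V. entry A k j) = c" if "k \<in> U" for k
    using that by auto
  have "entry (grouped A D S) U V = c"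
    using U V i c by (intro entry_groupedI) auto
  with c[OF i] show ?thesis by simp
qed

text \<open>
  Summing over \<open>k\<close> block by block, the row sum of \<open>B\<close> over \<open>V\<close> can be pulled out of each block of
  the common partition \<open>E\<close>.
\<close>

lemma block_sum_lmult:
  assumes fin: "finite (col_labels A)" and lab: "col_labels A = row_labels B"
    and D: "partition_on (row_labels A) D" and E: "partition_on (col_labels A) E"
    and F: "partition_on (col_labels B) F"
    and A: "block_generalized_stochastic A D E" and B: "block_generalized_stochastic B E F"
    and U: "U \<in> D" and V: "V \<in> F" and i: "i \<in> U"
  shows "(\<Sum>j\<in>V. entry (A \<cdot> B) i j) = entry (grouped A D E \<cdot> grouped B E F) U V"
proof -
  have i': "i \<in> row_labels A"
    using U i partition_onD1[OF D] by blast
  have V': "V \<subseteq> col_labels B"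
    using V partition_onD1[OF F] by blast
  have E': "partition_on (row_labels B) E"
    using E lab by simp
  have union: "col_labels A = \<Union>E"
    using partition_onD1[OF E] .
  have finW: "\<forall>W\<in>E. finite W"
    using fin union by (auto intro: finite_subset)
  have disj: "\<forall>W\<in>E. \<forall>W'\<in>E. W \<noteq> W' \<longrightarrow> W \<inter> W' = {}"
    using partition_onD2[OF E] by (auto simp: disjoint_def)
  have "(\<Sum>j\<in>V. entry (A \<cdot> B) i j)
      = (\<Sum>j\<in>V. \<Sum>k\<in>col_labels A. entry A i k * entry B k j)"
    using i' V' by (intro sum.cong) (auto simp: entry_lmult)
  also have "\<dots> = (\<Sum>k\<in>col_labels A. entry A i k * (\<Sum>j\<in>V. entry B k j))"
    by (subst sum.swap) (simp add: sum_distrib_left)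
  also have "\<dots> = (\<Sum>W\<in>E. \<Sum>k\<in>W. entry A i k * (\<Sum>j\<in>V. entry B k j))"
    using sum.Union_disjoint[OF finW disj] by (simp add: union)
  also have "\<dots> = (\<Sum>W\<in>E. entry (grouped A D E) U W * entry (grouped B E F) W V)"
  proof (rule sum.cong[OF refl])
    fix W assume W: "W \<in> E"
    have "(\<Sum>k\<in>W. entry A i k * (\<Sum>j\<in>V. entry B k j))
        = (\<Sum>k\<in>W. entry A i k * entry (grouped B E F) W V)"
      using block_sum_eq_entry_grouped[OF E' F B W V] by (intro sum.cong) auto
    also have "\<dots> = (\<Sum>k\<in>W. entry A i k) * entry (grouped B E F) W V"
      by (simp add: sum_distrib_right)
    also have "(\<Sum>k\<in>W. entry A i k) = entry (grouped A D E) U W"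
      by (rule block_sum_eq_entry_grouped[OF D E A U W i])
    finally show "(\<Sum>k\<in>W. entry A i k * (\<Sum>j\<in>V. entry B k j))
        = entry (grouped A D E) U W * entry (grouped B E F) W V" .
  qed
  also have "\<dots> = entry (grouped A D E \<cdot> grouped B E F) U V"
    using U V by (simp add: entry_lmult)
  finally show ?thesis .
qed

lemma block_generalized_stochastic_lmult:
  assumes "finite (col_labels A)" "col_labels A = row_labels B"
    and "partition_on (row_labels A) D" "partition_on (col_labels A) E"
    and "partition_on (col_labels B) F"
    and "block_generalized_stochastic A D E" "block_generalized_stochastic B E F"
  shows "block_generalized_stochastic (A \<cdot> B) D F"
  using block_sum_lmult[OF assms] assms(3,5) by (intro block_generalized_stochasticI) simp_all

lemma grouped_lmult:
  assumes "finite (col_labels A)" "col_labels A = row_labels B"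
    and D: "partition_on (row_labels A) D" and "partition_on (col_labels A) E"
    and "partition_on (col_labels B) F"
    and "block_generalized_stochastic A D E" "block_generalized_stochastic B E F"
  shows "grouped (A \<cdot> B) D F = grouped A D E \<cdot> grouped B E F"
proof (rule lmat_eqI)
  fix U V
  assume UV: "U \<in> row_labels (grouped (A \<cdot> B) D F)" "V \<in> col_labels (grouped (A \<cdot> B) D F)"
  moreover have "U \<noteq> {}"
    using UV(1) partition_onD3[OF D] by auto
  ultimately show "entry (grouped (A \<cdot> B) D F) U V = entry (grouped A D E \<cdot> grouped B E F) U V"
    using block_sum_lmult[OF assms] by (intro entry_groupedI) simp_all
qed simp_all

text \<open>
  A row sum over a singleton block inside \<open>K\<close> reads one entry, and the restriction to \<open>K\<close> keeps
  that entry.  So $(P_1^K)^{-+}$ consists of the columns of $P_1^{-+}$ labelled by these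
  singletons.
\<close>

lemma grouped_sub_cols_singletons:
  assumes "singletons K \<subseteq> S"
  shows "grouped (sub_cols A K) D (singletons K) = sub_cols (grouped A D S) (singletons K)"
proof (rule lmat_eqI)
  fix U V
  assume U: "U \<in> row_labels (grouped (sub_cols A K) D (singletons K))"
    and V: "V \<in> col_labels (grouped (sub_cols A K) D (singletons K))"
  then obtain j where "j \<in> K" "V = {j}"
    by (auto simp: singletons_def)
  with U V assms show "entry (grouped (sub_cols A K) D (singletons K)) U V
      = entry (sub_cols (grouped A D S) (singletons K)) U V"
    by (auto simp: entry_sub_cols grouped_def)
qed (use assms in auto)

section \<open>Products of stochastic matrices and opinions\<close>

lemma G_set_iff:
  "A \<in> G_set r D S \<longleftrightarrow> A \<in> stochastic_matrices r \<and> block_generalized_stochastic A D S"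
  by (simp add: G_set_def block_generalized_stochastic_def)

lemma stochastic_matrices_labels:
  assumes "A \<in> stochastic_matrices r"
  shows "row_labels A = {1..r}" and "col_labels A = {1..r}"
  using assms by (simp_all add: stochastic_matrices_def)

lemma full_prod_grouped:
  assumes part: "\<And>b. b \<in> {1..t+1} \<Longrightarrow> partition_on {1..r} (\<Delta> b)"
    and G: "\<And>b. b \<in> {1..t} \<Longrightarrow> P b \<in> G_set r (\<Delta> (b + 1)) (\<Delta> b)"
    and n: "1 \<le> n" "n \<le> t"
  shows "block_generalized_stochastic (full_prod P n) (\<Delta> (n + 1)) (\<Delta> 1)"
    and "grouped (full_prod P n) (\<Delta> (n + 1)) (\<Delta> 1) = full_prod (grouped_seq P \<Delta>) n"
proof -
  have "block_generalized_stochastic (full_prod P n) (\<Delta> (n + 1)) (\<Delta> 1) \<and>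
      grouped (full_prod P n) (\<Delta> (n + 1)) (\<Delta> 1) = full_prod (grouped_seq P \<Delta>) n"
    using n
  proof (induction n rule: dec_induct)
    case base
    then show ?case
      using G[of 1] by (simp add: G_set_iff grouped_seq_def)
  next
    case (step m)
    have lab: "row_labels (P b) = {1..r}" "col_labels (P b) = {1..r}" if "b \<in> {1..t}" for b
      using G[OF that] stochastic_matrices_labels by (auto simp: G_set_iff)
    let ?A = "P (Suc m)" and ?B = "full_prod P m"
    have labB: "row_labels ?B = {1..r}" "col_labels ?B = {1..r}"
      using step lab[of m] lab[of 1] by (simp_all add: row_labels_full_prod del: One_nat_def)
    have labA: "row_labels ?A = {1..r}" "col_labels ?A = {1..r}"
      using step lab[of "Suc m"] by simp_all
    have A: "block_generalized_stochastic ?A (\<Delta> (Suc m + 1)) (\<Delta> (m + 1))"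
      using G[of "Suc m"] step by (simp add: G_set_iff)
    have IH: "block_generalized_stochastic ?B (\<Delta> (m + 1)) (\<Delta> 1)"
        "grouped ?B (\<Delta> (m + 1)) (\<Delta> 1) = full_prod (grouped_seq P \<Delta>) m"
      using step by simp_all
    have prems: "finite (col_labels ?A)" "col_labels ?A = row_labels ?B"
        "partition_on (row_labels ?A) (\<Delta> (Suc m + 1))"
        "partition_on (col_labels ?A) (\<Delta> (m + 1))"
        "partition_on (col_labels ?B) (\<Delta> 1)"
      unfolding labA labB using step.prems by (auto intro!: part simp del: One_nat_def)
    show ?case
      using block_generalized_stochastic_lmult[OF prems A IH(1)]
        grouped_lmult[OF prems A IH(1)] IH(2) step.hyps
      by (simp add: back_prod_Suc grouped_seq_def[of P \<Delta> "Suc m"])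
  qed
  then show "block_generalized_stochastic (full_prod P n) (\<Delta> (n + 1)) (\<Delta> 1)"
    and "grouped (full_prod P n) (\<Delta> (n + 1)) (\<Delta> 1) = full_prod (grouped_seq P \<Delta>) n"
    by blast+
qed

text \<open>Each new entry of the column is an average of equal numbers.\<close>

lemma constant_column_persists:
  assumes P: "\<And>n. n \<ge> 1 \<Longrightarrow> P n \<in> stochastic_matrices r"
    and t: "t \<ge> 1" and j: "j \<in> {1..r}"
    and const: "\<And>i. i \<in> {1..r} \<Longrightarrow> entry (full_prod P t) i j = c"
    and n: "n \<ge> t" and l: "l \<in> {1..r}"
  shows "entry (full_prod P n) l j = c"
  using n l
proof (induction n arbitrary: l rule: dec_induct)
  case base
  then show ?case by (rule const)
next
  case (step n)
  note lab = stochastic_matrices_labels[OF P]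
  have n1: "n \<ge> 1"
    using step t by simp
  have "entry (full_prod P (Suc n)) l j
      = (\<Sum>k\<in>{1..r}. entry (P (Suc n)) l k * entry (full_prod P n) k j)"
    using n1 step.prems j lab by (simp add: back_prod_Suc entry_lmult)
  also have "\<dots> = (\<Sum>k\<in>{1..r}. entry (P (Suc n)) l k) * c"
    by (simp add: step.IH sum_distrib_right del: One_nat_def)
  also have "\<dots> = c"
    using P[of "Suc n"] step.prems by (simp add: stochastic_matrices_def)
  finally show ?case .
qed

lemma opinion_eq_full_prod:
  assumes P: "\<And>n. n \<ge> 1 \<Longrightarrow> P n \<in> stochastic_matrices r"
    and n: "n \<ge> 1" and l: "l \<in> {1..r}"
  shows "opinion r P p0 n l = (\<Sum>j\<in>{1..r}. entry (full_prod P n) l j *\<^sub>R p0 j)"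
  using n l
proof (induction n arbitrary: l rule: dec_induct)
  case base
  then show ?case by simp
next
  case (step n)
  note lab = stochastic_matrices_labels[OF P]
  have "opinion r P p0 (Suc n) l = (\<Sum>k\<in>{1..r}. \<Sum>j\<in>{1..r}.
      (entry (P (Suc n)) l k * entry (full_prod P n) k j) *\<^sub>R p0 j)"
    by (simp add: step.IH scaleR_right.sum)
  also have "\<dots> = (\<Sum>j\<in>{1..r}. \<Sum>k\<in>{1..r}.
      (entry (P (Suc n)) l k * entry (full_prod P n) k j) *\<^sub>R p0 j)"
    by (rule sum.swap)
  also have "\<dots> = (\<Sum>j\<in>{1..r}. entry (full_prod P (Suc n)) l j *\<^sub>R p0 j)"
    using step lab by (intro sum.cong) (simp_all add: back_prod_Suc entry_lmult scaleR_left.sum)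
  finally show ?case .
qed

lemma consensus_atI:
  assumes "\<And>n l. n \<ge> t \<Longrightarrow> l \<in> {1..r} \<Longrightarrow> opinion r P p0 n l = c"
  shows "consensus_at r P p0 t c"
  unfolding consensus_at_def consensus_def
  using assms by (auto intro!: tendsto_eventually eventually_sequentiallyI[of t])

section \<open>Consensus and partial consensus\<close>

lemma singleton_mem_singletons_and_rest:
  assumes "j \<in> {1..r}" and "j \<in> K \<or> card ({1..r} - K) \<le> 1"
  shows "{j} \<in> singletons_and_rest r K"
proof (cases "j \<in> K")
  case True
  then show ?thesis by (simp add: singletons_and_rest_def singletons_def)
next
  case False
  then have j: "j \<in> {1..r} - K"
    using assms(1) by simp
  moreover have "card ({1..r} - K) \<le> Suc 0"
    using False assms(2) by simp
  ultimately have "{1..r} - K = {j}"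
    by (auto simp: card_le_Suc0_iff_eq)
  then show ?thesis by (simp add: singletons_and_rest_def)
qed

theorem theorem2p5:
  fixes r t :: nat
    and P :: "nat \<Rightarrow> (nat, nat) lmat"
    and p0 :: "nat \<Rightarrow> 'a::real_normed_field"
    and \<Delta> :: "nat \<Rightarrow> nat set set"
    and K :: "nat set"
  assumes "r \<ge> 2"
    and "\<And>n. n \<ge> 1 \<Longrightarrow> P n \<in> stochastic_matrices r"
    and "t \<ge> 1"
    and "\<And>b. b \<in> {1..t+1} \<Longrightarrow> partition_on {1..r} (\<Delta> b)"
    and "\<And>b. b \<in> {1..t} \<Longrightarrow> P b \<in> G_set r (\<Delta> (b + 1)) (\<Delta> b)"
    and "\<Delta> (t + 1) = {{1..r}}"
    and "K \<noteq> {}" and "K \<subseteq> {1..r}"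
    and "\<Delta> 1 = singletons_and_rest r K"
  shows
    "(sub_cols (full_prod P t) K = back_prod P t (sub_cols (P 1) K)
        \<and> stable_matrix (sub_cols (full_prod P t) K)
        \<and> stable_matrix (back_prod P t (sub_cols (P 1) K)))
      \<and> (\<forall>i\<in>{1..r}.
        eq_relabel (\<lambda>_. {1..r}) (\<lambda>j. {j})
          (sub_rows (sub_cols (full_prod P t) K) {i})
          (sub_cols (full_prod (grouped_seq P \<Delta>) t) (singletons K)))
      \<and> (sub_cols (full_prod (grouped_seq P \<Delta>) t) (singletons K)
        = back_prod (grouped_seq P \<Delta>) t (grouped (sub_cols (P 1) K) (\<Delta> 2) (singletons K)))
      \<and> (eq_relabel (\<lambda>i. i) (\<lambda>j. {j})
          (sub_cols (full_prod P t) K)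
          (ones_column r \<cdot> sub_cols (full_prod (grouped_seq P \<Delta>) t) (singletons K)))
      \<and> (ones_column r \<cdot> sub_cols (full_prod (grouped_seq P \<Delta>) t) (singletons K)
        = ones_column r \<cdot>
          back_prod (grouped_seq P \<Delta>) t (grouped (sub_cols (P 1) K) (\<Delta> 2) (singletons K)))
      \<and> (\<forall>n\<ge>t. \<forall>l\<in>{1..r}. opinion r P p0 n l =
        (if card ({1..r} - K) \<le> 1
         then \<Sum>j\<in>{1..r}. entry (full_prod (grouped_seq P \<Delta>) t) {1..r} {j} *\<^sub>R p0 j
         else (\<Sum>j\<in>K. entry (full_prod (grouped_seq P \<Delta>) t) {1..r} {j} *\<^sub>R p0 j)
              + (\<Sum>u\<in>{1..r} - K. entry (full_prod P n) l u *\<^sub>R p0 u)))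
      \<and> (\<forall>n\<ge>t. \<forall>l\<in>{1..r}. contribution P p0 K n l =
        (\<Sum>j\<in>K. entry (full_prod (grouped_seq P \<Delta>) t) {1..r} {j} *\<^sub>R p0 j))
      \<and> (card ({1..r} - K) \<le> 1 \<longrightarrow>
        consensus_at r P p0 t
          (\<Sum>j\<in>{1..r}. entry (full_prod (grouped_seq P \<Delta>) t) {1..r} {j} *\<^sub>R p0 j))
      \<and> (card ({1..r} - K) > 1 \<longrightarrow>
        partial_consensus_at r P p0 K t
          (\<Sum>j\<in>K. entry (full_prod (grouped_seq P \<Delta>) t) {1..r} {j} *\<^sub>R p0 j))"
proof -
  note P = assms(2) and t = assms(3) and part = assms(4) and G = assms(5)
    and top = assms(6) and Kr = assms(8) and D1 = assms(9)
  note lab = stochastic_matrices_labels[OF P]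
  let ?A = "full_prod P t" and ?Q = "full_prod (grouped_seq P \<Delta>) t"
  have labA: "row_labels ?A = {1..r}" "col_labels ?A = {1..r}"
    using t lab by (simp_all add: row_labels_full_prod del: One_nat_def)
  have labQ: "row_labels ?Q = {{1..r}}" "col_labels ?Q = \<Delta> 1"
    using t top row_labels_full_prod[OF t, of "grouped_seq P \<Delta>"] by (simp_all add: grouped_seq_def)
  have K1: "singletons K \<subseteq> \<Delta> 1"
    unfolding D1 by (simp add: singletons_and_rest_def)

  have grp: "block_generalized_stochastic ?A {{1..r}} (\<Delta> 1)" "grouped ?A {{1..r}} (\<Delta> 1) = ?Q"
    using full_prod_grouped[of t r \<Delta> P t] part G t top by simp_all
  have col_t: "entry ?A i j = entry ?Q {1..r} {j}"
    if "i \<in> {1..r}" "{j} \<in> \<Delta> 1" for i j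
    using block_sum_eq_entry_grouped[of ?A "{{1..r}}" "\<Delta> 1" "{1..r}" "{j}" i]
      that grp part[of 1] part[of "t + 1"] labA top t by simp
  have col_n: "entry (full_prod P n) l j = entry ?Q {1..r} {j}"
    if "n \<ge> t" "l \<in> {1..r}" "j \<in> {1..r}" "{j} \<in> \<Delta> 1" for n l j
    by (rule constant_column_persists[where P = P, OF P t that(3) col_t[OF _ that(4)] that(1,2)])
  have KD: "{j} \<in> \<Delta> 1" if "j \<in> K" for j
    using K1 that by (auto simp: singletons_def)

  have sub: "sub_cols ?A K = back_prod P t (sub_cols (P 1) K)"
    using t by (rule sub_cols_back_prod)
  have stable: "stable_matrix (sub_cols ?A K)"
    using labA col_t KD by (auto simp: stable_matrix_def entry_sub_cols)
  have entryK: "entry (sub_cols ?A K) i j = entry (sub_cols ?Q (singletons K)) {1..r} {j}"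
    if "i \<in> {1..r}" "j \<in> K" for i j
    using that col_t KD by (simp add: entry_sub_cols singletons_def)
  have colK: "col_labels (sub_cols ?A K) = K" "col_labels (sub_cols ?Q (singletons K)) = singletons K"
    using Kr K1 labA labQ by auto
  have bij: "bij_betw (\<lambda>j. {j}) K (singletons K)"
    by (auto simp: bij_betw_def singletons_def)

  have row: "eq_relabel (\<lambda>_. {1..r}) (\<lambda>j. {j}) (sub_rows (sub_cols ?A K) {i})
      (sub_cols ?Q (singletons K))" if "i \<in> {1..r}" for i
    unfolding eq_relabel_def
    using that bij entryK colK labA labQ by (auto simp: sub_rows_def submat_def bij_betw_def)
  have all_rows: "eq_relabel (\<lambda>i. i) (\<lambda>j. {j}) (sub_cols ?A K)
      (ones_column r \<cdot> sub_cols ?Q (singletons K))"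
    unfolding eq_relabel_def
  proof (intro conjI ballI)
    fix i j assume "i \<in> row_labels (sub_cols ?A K)" "j \<in> col_labels (sub_cols ?A K)"
    then have ij: "i \<in> {1..r}" "j \<in> K"
      using colK labA by auto
    then have "entry (ones_column r \<cdot> sub_cols ?Q (singletons K)) i {j}
        = entry (sub_cols ?Q (singletons K)) {1..r} {j}"
      using colK(2) by (simp add: entry_lmult ones_column_def singletons_def)
    with entryK[OF ij] show "entry (sub_cols ?A K) i j
        = entry (ones_column r \<cdot> sub_cols ?Q (singletons K)) i {j}" by simp
  qed (use bij colK labA in \<open>simp_all add: ones_column_def bij_betw_def\<close>)
  have grouped_sub: "sub_cols ?Q (singletons K) =
      back_prod (grouped_seq P \<Delta>) t (grouped (sub_cols (P 1) K) (\<Delta> 2) (singletons K))"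
    unfolding sub_cols_back_prod[OF t] grouped_sub_cols_singletons[OF K1]
    by (simp add: grouped_seq_def[of P \<Delta> "Suc 0"] numeral_2_eq_2)

  have op: "opinion r P p0 n l = (\<Sum>j\<in>{1..r}. entry (full_prod P n) l j *\<^sub>R p0 j)"
    if "n \<ge> t" "l \<in> {1..r}" for n l
    using that(1) t by (intro opinion_eq_full_prod[where P = P, OF P _ that(2)]) simp_all
  have contrib: "contribution P p0 K n l = (\<Sum>j\<in>K. entry ?Q {1..r} {j} *\<^sub>R p0 j)"
    if "n \<ge> t" "l \<in> {1..r}" for n l
    unfolding contribution_def
    by (rule sum.cong[OF refl]) (use that Kr KD col_n in auto)
  have total: "opinion r P p0 n l = (\<Sum>j\<in>{1..r}. entry ?Q {1..r} {j} *\<^sub>R p0 j)"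
    if "card ({1..r} - K) \<le> 1" "n \<ge> t" "l \<in> {1..r}" for n l
    unfolding op[OF that(2,3)]
  proof (rule sum.cong[OF refl])
    fix j assume j: "j \<in> {1..r}"
    with that(1) have "{j} \<in> \<Delta> 1"
      unfolding D1 by (intro singleton_mem_singletons_and_rest) auto
    with col_n[OF that(2,3) j]
    show "entry (full_prod P n) l j *\<^sub>R p0 j = entry ?Q {1..r} {j} *\<^sub>R p0 j" by simp
  qed
  have partial: "opinion r P p0 n l = (\<Sum>j\<in>K. entry ?Q {1..r} {j} *\<^sub>R p0 j)
      + (\<Sum>u\<in>{1..r} - K. entry (full_prod P n) l u *\<^sub>R p0 u)"
    if "n \<ge> t" "l \<in> {1..r}" for n l
    using op[OF that] contrib[OF that, unfolded contribution_def]
      sum.subset_diff[OF Kr, of "\<lambda>j. entry (full_prod P n) l j *\<^sub>R p0 j"]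
    by (simp add: add.commute)

  have cons: "consensus_at r P p0 t (\<Sum>j\<in>{1..r}. entry ?Q {1..r} {j} *\<^sub>R p0 j)"
    if "card ({1..r} - K) \<le> 1"
    using total[OF that] by (rule consensus_atI)
  have partial_cons: "partial_consensus_at r P p0 K t (\<Sum>j\<in>K. entry ?Q {1..r} {j} *\<^sub>R p0 j)"
    using contrib by (simp add: partial_consensus_at_def)
  show ?thesis
    using sub stable stable[unfolded sub] row all_rows grouped_sub
      arg_cong[OF grouped_sub, of "(\<cdot>) (ones_column r)"] total partial contrib cons partial_cons
    by (intro conjI allI ballI impI) simp_all
qed

end
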